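(* Let $\mathcal{M}$ be a constrained Markov decision process with transition kernel $p$, let $k_*$ be its minimal required budget, and let $\hat p$ be a consistent kernel of $p$. Define $k_0(s,a)=0$ for all $(s,a)\in\mathcal{S}\times\mathcal{A}$ and, for $n\ge0$, $$k_{n+1}(s,a)=\max_{s':\,\hat p(s'\mid s,a)>0}\Big[\mathbf{1}\{\hat p(d=1\mid s,a,s')>0\}+\min_{a'\in\mathcal{A}}k_n(s',a')\Big]\qquad\forall (s,a)\in\mathcal{S}\times\mathcal{A}.$$ Then $\lim_{n\to\infty}k_n(s,a)=k_*(s,a)$ (in $\mathbb{N}\cup\{\infty\}$) for every $(s,a)\in\mathcal{S}\times\mathcal{A}$, where $k_*$ is the minimal budget of the true process $\mathcal{M}$.
   Context: A constrained Markov decision process (CMDP) $\mathcal{M}=(\mathcal{S},\mathcal{A},p,r,d)$ has a finite state set $\mathcal{S}$, a finite action set $\mathcal{A}$, and a transition kernel $p(s',r,d\mid s,a)$ giving the joint conditional law of the next state $S_{t+1}=s'$, the reward $R_{t+1}=r\in\mathbb{R}$ and the binary damage indicator $D_{t+1}=d\in\{0,1\}$ given $S_t=s,A_t=a$; $p(s',d\mid s,a)$, $p(s'\mid s,a)$ and $p(d\mid s,a,s')$ denote the corresponding marginal and conditional probabilities (similarly for $\hat p$). Standing assumptions: there is an absorbing termination state in which the system remains with no further reward, and it is eventually reached under any policy. A kernel $\hat p(s',d\mid s,a)$ is a consistent kernel of $p$ if and only if $\operatorname{sign}(\hat p(s',d\mid s,a))=\operatorname{sign}(p(s',d\mid s,a))$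 for all $(s,a,s',d)\in\mathcal{S}\times\mathcal{A}\times\mathcal{S}\times\{0,1\}$. The budget evolves as $K_{t+1}=K_t-D_{t+1}$. A stationary (memory) policy $\tilde\pi$ chooses $A_t$ from a distribution $\tilde\pi(\cdot\mid S_t,K_t)$ on $\mathcal{A}$ (choices at negative budgets arbitrary). For $k\in\mathbb{N}\cup\{\infty\}$ the barrier function is $$B_{\tilde\pi}(s,k,a)=\mathbb{E}_{\tilde\pi}\Big[\mathbb{I}\Big\{\sum_{\ell=t}^\infty D_{\ell+1}\le K_t\Big\}\,\Big|\,S_t=s,K_t=k,A_t=a\Big],$$ where $\mathbb{I}\{x\}=0$ if $x$ is true and $-\infty$ otherwise; so $B_{\tilde\pi}(s,k,a)=0$ if the total future damage is at most $k$ with probability one and $-\infty$ otherwise. The optimal barrier function is $B_*(s,k,a)=\max_{\tilde\pi}B_{\tilde\pi}(s,k,a)$ over stationary memory policies. The minimal required budget is $k_*(s,a)=\min\{k\in\{0,1,2,\dots\}\cup\{\infty\}: B_*(s,k,a)=0\}$ (the value $\infty$ is allowed). *)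

theory Defs
  imports "HOL-Probability.Probability"
begin

text \<open>
  The finite state and action sets are the finite types \<open>'s\<close> and \<open>'a\<close>.
  An outcome is a triple of next state, reward and damage indicator; since the
  reward may have an arbitrary law, kernels are measures rather than mass functions.
\<close>

type_synonym 's outcome = "'s \<times> real \<times> bool"
type_synonym ('s, 'a) kernel = "'s \<Rightarrow> 'a \<Rightarrow> 's outcome measure"

definition outcome_space :: "'s outcome measure" where
  "outcome_space = count_space UNIV \<Otimes>\<^sub>M borel \<Otimes>\<^sub>M count_space UNIV"

text \<open>
  Budgets live in \<open>\<int> \<union> {\<infinity>}\<close>, which is embedded in \<^typ>\<open>ereal\<close>; started from a budget in
  \<open>\<nat> \<union> {\<infinity>}\<close>, only integers and \<open>\<infinity>\<close> are ever reached, so the value of a policy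
  at any other extended real is irrelevant.
\<close>

type_synonym ('s, 'a) policy = "'s \<Rightarrow> ereal \<Rightarrow> 'a pmf"

text \<open>
  A trajectory \<open>\<omega>\<close> consists of the pairs
  \<open>\<omega> t = (A\<^sub>t, (S\<^bsub>t+1\<^esub>, R\<^bsub>t+1\<^esub>, D\<^bsub>t+1\<^esub>))\<close>; the initial state and
  budget are kept separately.
\<close>

type_synonym ('s, 'a) trajectory = "nat \<Rightarrow> 'a \<times> 's outcome"

definition next_damage :: "('s, 'a) trajectory \<Rightarrow> nat \<Rightarrow> bool" where
  "next_damage \<omega> t = snd (snd (snd (\<omega> t)))"

primrec state_at :: "'s \<Rightarrow> ('s, 'a) trajectory \<Rightarrow> nat \<Rightarrow> 's" where
  "state_at s \<omega> 0 = s"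
| "state_at s \<omega> (Suc t) = fst (snd (\<omega> t))"

primrec budget_at :: "ereal \<Rightarrow> ('s, 'a) trajectory \<Rightarrow> nat \<Rightarrow> ereal" where
  "budget_at k \<omega> 0 = k"
| "budget_at k \<omega> (Suc t) = budget_at k \<omega> t - of_bool (next_damage \<omega> t)"

definition step_space :: "('a \<times> 's outcome) measure" where
  "step_space = count_space UNIV \<Otimes>\<^sub>M outcome_space"

definition step_law :: "('s, 'a) kernel \<Rightarrow> 'a pmf \<Rightarrow> 's \<Rightarrow> ('a \<times> 's outcome) measure" where
  "step_law p \<alpha> s = measure_pmf \<alpha> \<bind> (\<lambda>a. distr (p s a) step_space (Pair a))"

definition trajectory_step ::
  "('s, 'a) kernel \<Rightarrow> ('s, 'a) policy \<Rightarrow> 's \<Rightarrow> enat \<Rightarrow> 'a pmf \<Rightarrow>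
    nat \<Rightarrow> ('s, 'a) trajectory \<Rightarrow> ('a \<times> 's outcome) measure" where
  "trajectory_step p \<pi> s k \<alpha> t \<omega> =
     step_law p (if t = 0 then \<alpha> else \<pi> (state_at s \<omega> t) (budget_at (ereal_of_enat k) \<omega> t))
       (state_at s \<omega> t)"

text \<open>
  The law of the process started with state \<open>s\<close> and budget \<open>k\<close> in which the first action is
  drawn from \<open>\<alpha>\<close> and all later ones from \<open>\<pi>\<close>: the measure on infinite
  trajectories given by the Ionescu-Tulcea theorem. The case \<open>\<alpha> = return_pmf a\<close> is
  the conditional law of the process given \<open>S\<^sub>t = s, K\<^sub>t = k, A\<^sub>t = a\<close>, with time
  counted from \<open>t\<close>.
\<close>

definition trajectory_law ::
  "('s, 'a) kernel \<Rightarrow> ('s, 'a) policy \<Rightarrow> 's \<Rightarrow> enat \<Rightarrow> 'a pmf \<Rightarrow> ('s, 'a) trajectory measure" where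
  "trajectory_law p \<pi> s k \<alpha> =
     projective_family.lim UNIV
       (Ionescu_Tulcea.CI (trajectory_step p \<pi> s k \<alpha>) (\<lambda>_. step_space)) (\<lambda>_. step_space)"

definition prob_kernel :: "('s, 'a) kernel \<Rightarrow> bool" where
  "prob_kernel p \<longleftrightarrow> (\<forall>s a. p s a \<in> space (prob_algebra outcome_space))"

definition termination_state :: "('s, 'a) kernel \<Rightarrow> 's \<Rightarrow> bool" where
  "termination_state p z \<longleftrightarrow> (\<forall>a. AE (s', r, d) in p z a. s' = z \<and> r = 0)"

definition cmdp :: "('s::finite, 'a::finite) kernel \<Rightarrow> bool" where
  "cmdp p \<longleftrightarrow> prob_kernel p \<and>
     (\<exists>z. termination_state p z \<and>
       (\<forall>\<pi> s k. AE \<omega> in trajectory_law p \<pi> s k (\<pi> s (ereal_of_enat k)). \<exists>t. state_at s \<omega> t = z))"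

definition barrier_indicator :: "bool \<Rightarrow> ereal" where
  "barrier_indicator b = (if b then 0 else - \<infinity>)"

definition total_damage :: "('s, 'a) trajectory \<Rightarrow> enat" where
  "total_damage \<omega> = (\<Sum>l. of_bool (next_damage \<omega> l))"

text \<open>
  The expectation of the nonpositive extended real variable
  \<open>barrier_indicator (total_damage \<omega> \<le> k)\<close> is minus the nonnegative integral of its negation.
\<close>

definition barrier :: "('s, 'a) kernel \<Rightarrow> ('s, 'a) policy \<Rightarrow> 's \<Rightarrow> enat \<Rightarrow> 'a \<Rightarrow> ereal" where
  "barrier p \<pi> s k a =
     - enn2ereal (\<integral>\<^sup>+\<omega>. e2ennreal (- barrier_indicator (total_damage \<omega> \<le> k))
          \<partial>trajectory_law p \<pi> s k (return_pmf a))"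

text \<open>\<open>barrier\<close> only takes the values \<open>0\<close> and \<open>-\<infinity>\<close>, so this is the maximum of a finite set.\<close>

definition optimal_barrier :: "('s, 'a) kernel \<Rightarrow> 's \<Rightarrow> enat \<Rightarrow> 'a \<Rightarrow> ereal" where
  "optimal_barrier p s k a = (MAX \<pi>. barrier p \<pi> s k a)"

definition min_budget :: "('s, 'a) kernel \<Rightarrow> 's \<Rightarrow> 'a \<Rightarrow> enat" where
  "min_budget p s a = (LEAST k. optimal_barrier p s k a = 0)"

definition state_damage_prob :: "('s, 'a) kernel \<Rightarrow> 's \<Rightarrow> 'a \<Rightarrow> 's \<Rightarrow> bool \<Rightarrow> real" where
  "state_damage_prob p s a s' d = measure (p s a) {(s', r, d) | r. True}"

type_synonym ('s, 'a) damage_kernel = "'s \<Rightarrow> 'a \<Rightarrow> ('s \<times> bool) pmf"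

definition consistent_kernel :: "('s, 'a) damage_kernel \<Rightarrow> ('s, 'a) kernel \<Rightarrow> bool" where
  "consistent_kernel q p \<longleftrightarrow>
     (\<forall>s a s' d. sgn (pmf (q s a) (s', d)) = sgn (state_damage_prob p s a s' d))"

definition next_state_prob :: "('s, 'a) damage_kernel \<Rightarrow> 's \<Rightarrow> 'a \<Rightarrow> 's \<Rightarrow> real" where
  "next_state_prob q s a s' = pmf (map_pmf fst (q s a)) s'"

definition cond_damage_prob :: "('s, 'a) damage_kernel \<Rightarrow> 's \<Rightarrow> 'a \<Rightarrow> 's \<Rightarrow> bool \<Rightarrow> real" where
  "cond_damage_prob q s a s' d = pmf (q s a) (s', d) / next_state_prob q s a s'"

primrec budget_iter ::
  "('s::finite, 'a::finite) damage_kernel \<Rightarrow> nat \<Rightarrow> 's \<Rightarrow> 'a \<Rightarrow> enat" where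
  "budget_iter q 0 = (\<lambda>s a. 0)"
| "budget_iter q (Suc n) = (\<lambda>s a.
     MAX s'\<in>{s'. next_state_prob q s a s' > 0}.
       of_bool (cond_damage_prob q s a s' True > 0) + (MIN a'. budget_iter q n s' a'))"

text \<open>
  The conditions of the Ionescu-Tulcea theorem hold, so \<open>trajectory_law\<close> is the
  probability measure it is meant to be.
\<close>

lemma step_law_in_prob_algebra:
  assumes "prob_kernel p"
  shows "step_law p \<alpha> s \<in> space (prob_algebra step_space)"
proof -
  have pair: "Pair a \<in> measurable (p s a) step_space" for a
  proof -
    have "sets (p s a) = sets outcome_space"
      using assms by (simp add: prob_kernel_def space_prob_algebra)
    then show ?thesis
      unfolding step_space_def by measurable
  qed
  have "distr (p s a) step_space (Pair a) \<in> space (prob_algebra step_space)" for a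
    using assms pair[of a]
    by (simp add: prob_kernel_def space_prob_algebra prob_space.prob_space_distr)
  then have "(\<lambda>a. distr (p s a) step_space (Pair a)) \<in> count_space UNIV \<rightarrow>\<^sub>M prob_algebra step_space"
    by simp
  moreover have "measure_pmf \<alpha> \<in> space (prob_algebra (count_space UNIV))"
    by (simp add: space_prob_algebra measure_pmf.prob_space_axioms)
  ultimately show ?thesis
    unfolding step_law_def using prob_space_bind' sets_bind' by (subst space_prob_algebra) blast
qed

lemma measurable_next_damage:
  assumes "t \<in> I"
  shows "(\<lambda>\<omega>. next_damage \<omega> t) \<in> measurable (PiM I (\<lambda>_. step_space)) (count_space UNIV)"
proof -
  have "(\<lambda>\<omega>. \<omega> t) \<in> measurable (PiM I (\<lambda>_. step_space)) step_space"
    using assms by (rule measurable_component_singleton)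
  then show ?thesis
    unfolding next_damage_def step_space_def outcome_space_def by measurable
qed

lemma measurable_state_at:
  assumes "{..<t} \<subseteq> I"
  shows "(\<lambda>\<omega>. state_at s \<omega> t) \<in> measurable (PiM I (\<lambda>_. step_space)) (count_space UNIV)"
proof (cases t)
  case (Suc u)
  then have "(\<lambda>\<omega>. \<omega> u) \<in> measurable (PiM I (\<lambda>_. step_space)) step_space"
    using assms by (intro measurable_component_singleton) auto
  then show ?thesis
    unfolding Suc state_at.simps step_space_def outcome_space_def by measurable
qed simp

lemma measurable_budget_at:
  assumes "{..<t} \<subseteq> I"
  shows "(\<lambda>\<omega>. budget_at k \<omega> t)
    \<in> measurable (PiM I (\<lambda>_. step_space :: ('a \<times> 's outcome) measure)) (count_space UNIV)"
  using assms
proof (induction t)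
  case (Suc t)
  let ?M = "PiM I (\<lambda>_. step_space :: ('a \<times> 's outcome) measure)"
  have "(\<lambda>\<omega>. budget_at k \<omega> t) \<in> measurable ?M (count_space UNIV)"
    using Suc by (simp add: lessThan_Suc)
  then have "(\<lambda>\<omega>. budget_at k \<omega> t - of_bool b) \<in> measurable ?M (count_space UNIV)" for b
    by (rule measurable_compose) simp
  moreover have "(\<lambda>\<omega>. next_damage \<omega> t) \<in> measurable ?M (count_space UNIV)"
    using Suc.prems by (intro measurable_next_damage) auto
  ultimately have "(\<lambda>\<omega>. budget_at k \<omega> t - of_bool (next_damage \<omega> t)) \<in> measurable ?M (count_space UNIV)"
    by (rule measurable_compose_countable)
  then show ?case
    by simp
qed simp

lemma Ionescu_Tulcea_trajectory_step:
  fixes p :: "('s::finite, 'a::finite) kernel"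
  assumes "prob_kernel p"
  shows "Ionescu_Tulcea (trajectory_step p \<pi> s k \<alpha>) (\<lambda>_. step_space)"
  unfolding Ionescu_Tulcea_def
proof (intro conjI allI impI)
  show "trajectory_step p \<pi> s k \<alpha> t
      \<in> measurable (PiM {0..<t} (\<lambda>_. step_space)) (subprob_algebra step_space)" for t
  proof -
    let ?M = "PiM {0..<t} (\<lambda>_. step_space :: ('a \<times> 's outcome) measure)"
    let ?g = "\<lambda>x \<omega>. step_law p (if t = 0 then \<alpha> else \<pi> x (budget_at (ereal_of_enat k) \<omega> t)) x"
    have sp: "step_law p \<beta> x \<in> space (subprob_algebra step_space)" for \<beta> x
      using step_law_in_prob_algebra[OF assms, of \<beta> x]
      by (simp add: space_prob_algebra space_subprob_algebra prob_space_imp_subprob_space)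
    have "?g x \<in> measurable ?M (subprob_algebra step_space)" for x
      by (rule measurable_compose[OF measurable_budget_at]) (auto simp: sp)
    then have "(\<lambda>\<omega>. ?g (state_at s \<omega> t) \<omega>) \<in> measurable ?M (subprob_algebra step_space)"
      by (rule measurable_compose_countable) (auto intro: measurable_state_at)
    then show ?thesis
      by (simp add: trajectory_step_def[abs_def])
  qed
next
  show "prob_space (trajectory_step p \<pi> s k \<alpha> t \<omega>)" for t \<omega>
    unfolding trajectory_step_def
    using step_law_in_prob_algebra[OF assms] by (simp add: space_prob_algebra)
qed

lemma trajectory_law:
  fixes p :: "('s::finite, 'a::finite) kernel"
  assumes "prob_kernel p"
  shows "prob_space (trajectory_law p \<pi> s k \<alpha>)"
    and "sets (trajectory_law p \<pi> s k \<alpha>) = sets (PiM UNIV (\<lambda>_. step_space))"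
proof -
  interpret Ionescu_Tulcea "trajectory_step p \<pi> s k \<alpha>" "\<lambda>_. step_space"
    using assms by (rule Ionescu_Tulcea_trajectory_step)
  show sets: "sets (trajectory_law p \<pi> s k \<alpha>) = sets (PiM UNIV (\<lambda>_. step_space))"
    unfolding trajectory_law_def by (rule PF.sets_lim)
  have "(\<lambda>x. restrict x {}) \<in> trajectory_law p \<pi> s k \<alpha> \<rightarrow>\<^sub>M PiM {} (\<lambda>_. step_space)"
    unfolding measurable_cong_sets[OF sets refl] by (rule measurable_restrict_subset) simp
  moreover have "prob_space (distr (trajectory_law p \<pi> s k \<alpha>) (PiM {} (\<lambda>_. step_space))
      (\<lambda>x. restrict x {}))"
    unfolding trajectory_law_def using PF.prob_space_P[of "{}"] by (simp add: distr_lim)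
  ultimately show "prob_space (trajectory_law p \<pi> s k \<alpha>)"
    by (rule prob_space_distrD)
qed

end

theory Submission
  imports Defs
begin

text \<open>
  The iterates increase to a limit \<open>k\<^sub>\<infinity>\<close>, and only the support of the kernel matters.
  Since there are finitely many actions, some action \<open>g s'\<close> attains the minimum of
  \<open>k\<^sub>n s'\<close> for infinitely many \<open>n\<close>. If \<open>g\<close> is followed from the second step on, then
  the damage so far plus \<open>k\<^sub>\<infinity>\<close> at the current state and action almost surely never
  exceeds its initial value, so \<open>k\<^sub>\<infinity>\<close> suffices as a budget. Conversely, against any
  policy choose the successor that attains the maximum in the recursion for \<open>k\<^sub>n\<close>, with
  damage whenever possible: together with any actions in the support of the policy these
  choices form an event of positive probability on which the damage in the first \<open>n\<close>
  steps is at least \<open>k\<^sub>n\<close>.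
\<close>

section \<open>One-step factorisation of Ionescu-Tulcea measures\<close>

lemma (in Ionescu_Tulcea) sets_extend_step:
  assumes [measurable]: "E \<in> sets (PiM {0..<n} M)" "B \<in> sets (M n)"
  shows "{x \<in> space (PiM {0..<Suc n} M). restrict x {0..<n} \<in> E \<and> x n \<in> B} \<in> sets (PiM {0..<Suc n} M)"
proof -
  have "(\<lambda>x. restrict x {0..<n}) \<in> PiM {0..<Suc n} M \<rightarrow>\<^sub>M PiM {0..<n} M"
    by (rule measurable_restrict_subset) auto
  moreover have "(\<lambda>x. x n) \<in> PiM {0..<Suc n} M \<rightarrow>\<^sub>M M n"
    by (rule measurable_component_singleton) simp
  ultimately show ?thesis
    by measurable
qed

text \<open>When \<open>eP n x\<close> is integrated over the law of the first \<open>n\<close>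
  coordinates, the section of the event at \<open>x\<close> is \<open>B\<close> if \<open>x\<close>
  lies in \<open>E\<close> and empty otherwise. As \<open>P n x\<close> gives \<open>B\<close> the
  same mass \<open>c\<close> at every \<open>x\<close> in \<open>E\<close>, the integrand is
  \<open>c\<close> times the indicator of \<open>E\<close>.\<close>

lemma (in Ionescu_Tulcea) emeasure_C_step:
  assumes E: "E \<in> sets (PiM {0..<n} M)" and B: "B \<in> sets (M n)"
    and c: "\<And>x. x \<in> E \<Longrightarrow> emeasure (P n x) B = c"
  shows "emeasure (C 0 (Suc n) (\<lambda>_. undefined))
      {x \<in> space (PiM {0..<Suc n} M). restrict x {0..<n} \<in> E \<and> x n \<in> B} =
    c * emeasure (C 0 n (\<lambda>_. undefined)) E"
proof -
  \<comment> \<open>\<open>?u\<close> is the empty history, the only element of the product over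
    \<open>{0..<0}\<close>.\<close>
  let ?u = "\<lambda>_. undefined" and ?X = "{x \<in> space (PiM {0..<Suc n} M). restrict x {0..<n} \<in> E \<and> x n \<in> B}"
  have u: "?u \<in> space (PiM {0..<0} M)"
    by (simp add: space_PiM)
  have X: "?X \<in> sets (PiM {0..<Suc n} M)"
    using E B by (rule sets_extend_step)
  have eP: "emeasure (eP n x) ?X = c * indicator E x" if x: "x \<in> space (PiM {0..<n} M)" for x
  proof -
    have upd: "x(n := y) \<in> space (PiM {0..<Suc n} M)" if "y \<in> space (M n)" for y
      using that x by (auto simp: space_PiM PiE_iff extensional_def)
    have res: "restrict (x(n := y)) {0..<n} = x" for y
      using x by (auto simp: space_PiM PiE_iff extensional_def fun_eq_iff)
    have "(\<lambda>y. x(n := y)) -` ?X \<inter> space (M n) = (if x \<in> E then B else {})"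
      using upd res sets.sets_into_space[OF B] by auto
    then show ?thesis
      using c by (subst emeasure_eP[OF x X]) (auto simp: indicator_def)
  qed
  have "emeasure (C 0 (Suc n) ?u) ?X = (\<integral>\<^sup>+x. emeasure (eP n x) ?X \<partial>C 0 n ?u)"
  proof -
    have "eP n \<in> C 0 n ?u \<rightarrow>\<^sub>M subprob_algebra (PiM {0..<Suc n} M)"
      using measurable_eP[of n] by (simp add: measurable_cong_sets[OF sets_C[OF u] refl])
    moreover have "space (C 0 n ?u) \<noteq> {}"
      using prob_space_C[OF u] by (rule prob_space.not_empty)
    ultimately show ?thesis
      using emeasure_bind[OF _ _ X] by simp
  qed
  also have "\<dots> = (\<integral>\<^sup>+x. c * indicator E x \<partial>C 0 n ?u)"
    by (intro nn_integral_cong eP) (simp add: space_C[OF u])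
  also have "\<dots> = c * emeasure (C 0 n ?u) E"
    by (intro nn_integral_cmult_indicator) (simp add: sets_C[OF u] E)
  finally show ?thesis .
qed

text \<open>The event is the cylinder over \<open>X\<close>, so the projective limit gives it the
  mass of a finite-dimensional marginal, which on an initial segment is \<open>C\<close>.\<close>

lemma (in Ionescu_Tulcea) emeasure_lim_C:
  assumes X: "X \<in> sets (PiM {0..<n} M)"
  shows "emeasure PF.lim {\<omega> \<in> space (PiM UNIV M). restrict \<omega> {0..<n} \<in> X} =
    emeasure (C 0 n (\<lambda>_. undefined)) X"
proof -
  have "{\<omega> \<in> space (PiM UNIV M). restrict \<omega> {0..<n} \<in> X} = PF.emb UNIV {0..<n} X"
    by (auto simp: prod_emb_def space_PiM)
  then show ?thesis
    using lim[OF _ X] emeasure_CI[OF _ X, of n] sets.sets_into_space[OF X]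
    by (simp add: prod_emb_id space_PiM)
qed

text \<open>Both events are cylinders, over \<open>Suc n\<close> and \<open>n\<close> coordinates,
  so the factorisation for \<open>C\<close> carries over to infinite trajectories.\<close>

lemma (in Ionescu_Tulcea) emeasure_lim_step:
  assumes E: "E \<in> sets (PiM {0..<n} M)" and B: "B \<in> sets (M n)"
    and c: "\<And>x. x \<in> E \<Longrightarrow> emeasure (P n x) B = c"
  shows "emeasure PF.lim {\<omega> \<in> space (PiM UNIV M). restrict \<omega> {0..<n} \<in> E \<and> \<omega> n \<in> B} =
    c * emeasure PF.lim {\<omega> \<in> space (PiM UNIV M). restrict \<omega> {0..<n} \<in> E}"
proof -
  let ?X = "{x \<in> space (PiM {0..<Suc n} M). restrict x {0..<n} \<in> E \<and> x n \<in> B}"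
  have X: "?X \<in> sets (PiM {0..<Suc n} M)"
    using E B by (rule sets_extend_step)
  have "{\<omega> \<in> space (PiM UNIV M). restrict \<omega> {0..<n} \<in> E \<and> \<omega> n \<in> B} =
      {\<omega> \<in> space (PiM UNIV M). restrict \<omega> {0..<Suc n} \<in> ?X}"
  proof -
    have "restrict (restrict \<omega> {0..<Suc n}) {0..<n} = restrict \<omega> {0..<n}" for \<omega> :: "nat \<Rightarrow> 'a"
      by (simp add: restrict_restrict Int_absorb1)
    then show ?thesis
      by (auto simp: space_PiM PiE_iff)
  qed
  then show ?thesis
    by (simp only: emeasure_lim_C[OF X] emeasure_lim_C[OF E] emeasure_C_step[OF E B c])
qed

section \<open>Damage counts and budgets along a trajectory\<close>

lemma space_step_space [simp]: "space step_space = UNIV"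
  by (simp add: step_space_def outcome_space_def space_pair_measure)

lemma state_at_restrict [simp]: "state_at s (restrict \<omega> {0..<t}) t = state_at s \<omega> t"
  by (cases t) auto

text \<open>The values are in \<open>nat\<close> so that fixing the state and the count at time
  \<open>t\<close> gives an event with a definite finite amount of damage spent.\<close>

definition damage_count :: "('s, 'a) trajectory \<Rightarrow> nat \<Rightarrow> nat" where
  "damage_count \<omega> t = (\<Sum>l<t. of_bool (next_damage \<omega> l))"

lemma damage_count_0 [simp]: "damage_count \<omega> 0 = 0"
  by (simp add: damage_count_def)

lemma damage_count_Suc [simp]:
  "damage_count \<omega> (Suc t) = damage_count \<omega> t + of_bool (next_damage \<omega> t)"
  by (simp add: damage_count_def)

lemma damage_count_restrict [simp]: "damage_count (restrict \<omega> {0..<t}) t = damage_count \<omega> t"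
  by (simp add: damage_count_def next_damage_def)

text \<open>The recursion unrolls even for infinite \<open>k\<close>, because only finite amounts
  are subtracted. After the first step, the law of the next action therefore depends on the past
  only through the state and the damage count.\<close>

lemma budget_at_eq: "budget_at k \<omega> t = k - ereal (real (damage_count \<omega> t))"
proof (induction t)
  case (Suc t)
  then show ?case
    by (cases k) (auto simp: of_bool_def one_ereal_def)
qed simp

lemma enat_damage_count: "enat (damage_count \<omega> t) = (\<Sum>l<t. of_bool (next_damage \<omega> l))"
proof (induction t)
  case (Suc t)
  have "enat (damage_count \<omega> (Suc t)) = enat (damage_count \<omega> t) + of_bool (next_damage \<omega> t)"
    by (simp add: zero_enat_def one_enat_def)
  then show ?case
    by (simp only: Suc.IH sum.lessThan_Suc)
qed (simp add: zero_enat_def)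

text \<open>A series in \<open>enat\<close> is the supremum of its partial sums. The countable
  conjunction makes the event measurable and lets it be checked one time at a time.\<close>

lemma total_damage_le_iff: "total_damage \<omega> \<le> k \<longleftrightarrow> (\<forall>t. enat (damage_count \<omega> t) \<le> k)"
  unfolding total_damage_def enat_damage_count
proof
  assume "\<forall>t. (\<Sum>l<t. of_bool (next_damage \<omega> l)) \<le> k"
  then show "(\<Sum>l. of_bool (next_damage \<omega> l)) \<le> k"
    by (intro suminf_le_const summableI) auto
next
  assume "(\<Sum>l. of_bool (next_damage \<omega> l)) \<le> k"
  moreover have "(\<Sum>l<t. of_bool (next_damage \<omega> l)) \<le> (\<Sum>l. of_bool (next_damage \<omega> l) :: enat)" for t
    by (intro sum_le_suminf summableI) auto
  ultimately show "\<forall>t. (\<Sum>l<t. of_bool (next_damage \<omega> l)) \<le> k"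
    using order_trans by blast
qed

lemma measurable_damage_count:
  assumes "{..<t} \<subseteq> I"
  shows "(\<lambda>\<omega>. damage_count \<omega> t)
    \<in> measurable (PiM I (\<lambda>_. step_space :: ('a \<times> 's outcome) measure)) (count_space UNIV)"
  using assms
proof (induction t)
  case (Suc t)
  let ?M = "PiM I (\<lambda>_. step_space :: ('a \<times> 's outcome) measure)"
  have [measurable]: "(\<lambda>\<omega>. next_damage \<omega> t) \<in> measurable ?M (count_space UNIV)"
    using Suc.prems by (intro measurable_next_damage) auto
  have [measurable]: "(\<lambda>\<omega>. damage_count \<omega> t) \<in> measurable ?M (count_space UNIV)"
    using Suc by (auto simp: lessThan_Suc)
  show ?case
    unfolding damage_count_Suc by measurable
qed simp

section \<open>Probabilities of a single step of the process\<close>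

text \<open>This is the cylinder factorisation for predicates on whole trajectories. The first
  condition on \<open>Q\<close> says that only the first \<open>t\<close> steps matter, the second
  that \<open>Q\<close> is measurable in terms of them. Constancy of the step probability on
  \<open>Q\<close> takes the place of conditioning on \<open>Q\<close>.\<close>

lemma emeasure_trajectory_law_step:
  fixes p :: "('s::finite, 'a::finite) kernel"
  assumes p: "prob_kernel p" and B: "B \<in> sets step_space"
    and Q: "\<And>\<omega>. Q (restrict \<omega> {0..<t}) \<longleftrightarrow> Q \<omega>"
      "{\<omega>. Q \<omega>} \<inter> space (PiM {0..<t} (\<lambda>_. step_space)) \<in> sets (PiM {0..<t} (\<lambda>_. step_space))"
    and c: "\<And>\<omega>. Q \<omega> \<Longrightarrow> emeasure (trajectory_step p \<pi> s k \<alpha> t \<omega>) B = c"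
  shows "emeasure (trajectory_law p \<pi> s k \<alpha>) {\<omega>. Q \<omega> \<and> \<omega> t \<in> B} =
    c * emeasure (trajectory_law p \<pi> s k \<alpha>) {\<omega>. Q \<omega>}"
proof -
  interpret Ionescu_Tulcea "trajectory_step p \<pi> s k \<alpha>" "\<lambda>_. step_space"
    using p by (rule Ionescu_Tulcea_trajectory_step)
  have "restrict \<omega> {0..<t} \<in> space (PiM {0..<t} (\<lambda>_. step_space))" for \<omega> :: "('s, 'a) trajectory"
    by (simp add: space_PiM)
  then show ?thesis
    using emeasure_lim_step[OF Q(2) B, of c] c Q(1)
    by (simp add: trajectory_law_def space_PiM)
qed

lemma emeasure_step_law:
  assumes p: "prob_kernel p" and B: "B \<in> sets step_space"
  shows "emeasure (step_law p \<alpha> s) B = (\<integral>\<^sup>+a. emeasure (p s a) (Pair a -` B) \<partial>measure_pmf \<alpha>)"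
proof -
  have sets_p: "sets (p s a) = sets outcome_space" for a
    using p by (simp add: prob_kernel_def space_prob_algebra)
  have pair: "Pair a \<in> measurable (p s a) step_space" for a
    using sets_p[of a] unfolding step_space_def by measurable
  have "distr (p s a) step_space (Pair a) \<in> space (subprob_algebra step_space)" for a
    using p pair[of a]
    by (simp add: prob_kernel_def space_prob_algebra space_subprob_algebra
        prob_space.prob_space_distr prob_space_imp_subprob_space)
  then have "(\<lambda>a. distr (p s a) step_space (Pair a)) \<in> measure_pmf \<alpha> \<rightarrow>\<^sub>M subprob_algebra step_space"
    by simp
  moreover have "space (p s a) = UNIV" for a
    using sets_eq_imp_space_eq[OF sets_p[of a]]
    by (simp add: outcome_space_def space_pair_measure)
  ultimately show ?thesis
    unfolding step_law_def using B by (simp add: emeasure_bind emeasure_distr pair)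
qed

section \<open>Barrier values as almost sure bounds\<close>

text \<open>The negated indicator is \<open>top\<close> where the budget is exceeded and 0
  elsewhere. Its integral is therefore 0 if that set is null and \<open>top\<close>
  otherwise.\<close>

lemma barrier_eq_0_iff:
  fixes p :: "('s::finite, 'a::finite) kernel"
  assumes "prob_kernel p"
  shows "barrier p \<pi> s k a = 0 \<longleftrightarrow>
      (AE \<omega> in trajectory_law p \<pi> s k (return_pmf a). total_damage \<omega> \<le> k)"
    and "barrier p \<pi> s k a \<in> {0, - \<infinity>}"
proof -
  let ?L = "trajectory_law p \<pi> s k (return_pmf a)"
  let ?N = "{\<omega> \<in> space ?L. \<not> total_damage \<omega> \<le> k}"
  note sets_L [measurable_cong] = trajectory_law(2)[OF assms, of \<pi> s k "return_pmf a"]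
  have [measurable]: "(\<lambda>\<omega>. damage_count \<omega> t) \<in> ?L \<rightarrow>\<^sub>M count_space UNIV" for t
    unfolding measurable_cong_sets[OF sets_L refl] by (rule measurable_damage_count) simp
  have N: "?N \<in> sets ?L"
    unfolding total_damage_le_iff by measurable
  have "(\<integral>\<^sup>+\<omega>. e2ennreal (- barrier_indicator (total_damage \<omega> \<le> k)) \<partial>?L) =
      (\<integral>\<^sup>+\<omega>. top * indicator ?N \<omega> \<partial>?L)"
    by (intro nn_integral_cong) (auto simp: barrier_indicator_def indicator_def)
  also have "\<dots> = top * emeasure ?L ?N"
    using N by (rule nn_integral_cmult_indicator)
  finally have b: "barrier p \<pi> s k a = - enn2ereal (top * emeasure ?L ?N)"
    by (simp add: barrier_def)
  have AE: "(AE \<omega> in ?L. total_damage \<omega> \<le> k) \<longleftrightarrow> emeasure ?L ?N = 0"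
    using N by (rule AE_iff_measurable) simp
  show "barrier p \<pi> s k a \<in> {0, - \<infinity>}"
    unfolding b by (cases "emeasure ?L ?N = 0") (auto simp: ennreal_top_mult zero_ennreal.rep_eq)
  show "barrier p \<pi> s k a = 0 \<longleftrightarrow> (AE \<omega> in ?L. total_damage \<omega> \<le> k)"
    unfolding b AE by (cases "emeasure ?L ?N = 0") (auto simp: ennreal_top_mult zero_ennreal.rep_eq)
qed

text \<open>Although there are infinitely many policies, their barriers lie in
  \<open>{0, - \<infinity>}\<close>. The maximum is thus taken over a finite set, and it is 0
  exactly when some policy attains 0.\<close>

lemma optimal_barrier_eq_0_iff:
  fixes p :: "('s::finite, 'a::finite) kernel"
  assumes "prob_kernel p"
  shows "optimal_barrier p s k a = 0 \<longleftrightarrow>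
      (\<exists>\<pi>. AE \<omega> in trajectory_law p \<pi> s k (return_pmf a). total_damage \<omega> \<le> k)"
proof -
  let ?R = "range (\<lambda>\<pi>. barrier p \<pi> s k a)"
  have sub: "?R \<subseteq> {0, - \<infinity>}"
    using barrier_eq_0_iff(2)[OF assms] by blast
  then have fin: "finite ?R"
    by (rule finite_subset) simp
  have "Max ?R = 0 \<longleftrightarrow> 0 \<in> ?R"
  proof
    assume "Max ?R = 0"
    then show "0 \<in> ?R"
      using Max_in[OF fin] by auto
  next
    assume "0 \<in> ?R"
    with sub fin show "Max ?R = 0"
      by (intro Max_eqI) auto
  qed
  also have "0 \<in> ?R \<longleftrightarrow> (\<exists>\<pi>. barrier p \<pi> s k a = 0)"
  proof
    assume "0 \<in> ?R"
    then obtain \<pi> where "0 = barrier p \<pi> s k a"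
      by (rule rangeE)
    then show "\<exists>\<pi>. barrier p \<pi> s k a = 0"
      by (intro exI) (rule sym)
  next
    assume "\<exists>\<pi>. barrier p \<pi> s k a = 0"
    then obtain \<pi> where "barrier p \<pi> s k a = 0"
      by (rule exE)
    then show "0 \<in> ?R"
      by (intro range_eqI) (rule sym)
  qed
  finally show ?thesis
    unfolding optimal_barrier_def barrier_eq_0_iff(1)[OF assms] .
qed

section \<open>The budget recursion and its limit\<close>

lemma next_state_prob_pos_iff: "next_state_prob q s a s' > 0 \<longleftrightarrow> (\<exists>d. pmf (q s a) (s', d) > 0)"
  unfolding next_state_prob_def pmf_positive_iff by force

text \<open>Division by a positive marginal keeps the sign. If the marginal is 0, so is the joint
  probability, and the quotient is 0 by the convention for division by zero.\<close>

lemma cond_damage_prob_pos_iff: "cond_damage_prob q s a s' d > 0 \<longleftrightarrow> pmf (q s a) (s', d) > 0"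
proof -
  have "next_state_prob q s a s' \<ge> 0"
    by (simp add: next_state_prob_def)
  then show ?thesis
    using next_state_prob_pos_iff[of q s a s']
    by (auto simp: cond_damage_prob_def zero_less_divide_iff not_less)
qed

lemma ex_next_state_prob_pos: "{s'. next_state_prob q s a s' > 0} \<noteq> {}"
  using set_pmf_not_empty[of "q s a"] by (auto simp: next_state_prob_pos_iff pmf_positive_iff)

text \<open>A transition with \<open>d = False\<close> contributes no damage, which the indicator in
  the recursion dominates. With the witness lemma below, this turns the recursion into a maximum
  over the pairs \<open>(s', d)\<close> in the support of \<open>q s a\<close>.\<close>

lemma budget_iter_Suc_ge:
  fixes q :: "('s::finite, 'a::finite) damage_kernel"
  assumes "pmf (q s a) (s', d) > 0"
  shows "of_bool d + (MIN a'. budget_iter q n s' a') \<le> budget_iter q (Suc n) s a"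
proof -
  have "of_bool d + (MIN a'. budget_iter q n s' a') \<le>
      of_bool (cond_damage_prob q s a s' True > 0) + (MIN a'. budget_iter q n s' a')"
    using assms by (intro add_right_mono) (auto simp: cond_damage_prob_pos_iff)
  also have "\<dots> \<le> budget_iter q (Suc n) s a"
    unfolding budget_iter.simps using assms
    by (intro Max_ge) (auto simp: next_state_prob_pos_iff)
  finally show ?thesis .
qed

lemma budget_iter_Suc_witness:
  fixes q :: "('s::finite, 'a::finite) damage_kernel"
  obtains s' d where "pmf (q s a) (s', d) > 0"
    and "budget_iter q (Suc n) s a = of_bool d + (MIN a'. budget_iter q n s' a')"
proof -
  let ?f = "\<lambda>s'. of_bool (cond_damage_prob q s a s' True > 0) + (MIN a'. budget_iter q n s' a')"
  have "Max (?f ` {s'. next_state_prob q s a s' > 0}) \<in> ?f ` {s'. next_state_prob q s a s' > 0}"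
    using ex_next_state_prob_pos[of q s a] by (intro Max_in) auto
  then obtain s' where s': "next_state_prob q s a s' > 0" and "budget_iter q (Suc n) s a = ?f s'"
    by auto
  \<comment> \<open>The chosen \<open>d\<close> is damage whenever damage is possible on the way to
    \<open>s'\<close>. If it is not, positivity of the marginal forces \<open>(s', False)\<close>
    into the support.\<close>
  moreover have "pmf (q s a) (s', cond_damage_prob q s a s' True > 0) > 0"
    using s' unfolding next_state_prob_pos_iff cond_damage_prob_pos_iff
    by (cases "pmf (q s a) (s', True) > 0") (auto, metis (full_types))
  ultimately show ?thesis
    using that by blast
qed

text \<open>The transition that attains \<open>budget_iter q (Suc n) s a\<close> also competes in
  the next maximum, where by induction its remaining value is at least as large. The induction
  starts because the first iterate is 0.\<close>

lemma budget_iter_le_Suc: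
  fixes q :: "('s::finite, 'a::finite) damage_kernel"
  shows "budget_iter q n s a \<le> budget_iter q (Suc n) s a"
proof (induction n arbitrary: s a)
  case (Suc n)
  obtain s' d where d: "pmf (q s a) (s', d) > 0"
    and "budget_iter q (Suc n) s a = of_bool d + (MIN a'. budget_iter q n s' a')"
    by (rule budget_iter_Suc_witness)
  note this(2)
  also have "(MIN a'. budget_iter q n s' a') \<le> (MIN a'. budget_iter q (Suc n) s' a')"
  proof (intro Min.boundedI)
    fix x assume "x \<in> range (budget_iter q (Suc n) s')"
    then obtain a' where "x = budget_iter q (Suc n) s' a'"
      by auto
    then show "(MIN a'. budget_iter q n s' a') \<le> x"
      using Suc.IH[of s' a'] by (meson Min_le finite finite_imageI order_trans rangeI)
  qed auto
  then have "of_bool d + (MIN a'. budget_iter q n s' a') \<le> of_bool d + (MIN a'. budget_iter q (Suc n) s' a')"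
    by (rule add_left_mono)
  also have "\<dots> \<le> budget_iter q (Suc (Suc n)) s a"
    using d by (rule budget_iter_Suc_ge)
  finally show ?case .
qed simp

definition budget_limit :: "('s::finite, 'a::finite) damage_kernel \<Rightarrow> 's \<Rightarrow> 'a \<Rightarrow> enat" where
  "budget_limit q s a = (SUP n. budget_iter q n s a)"

lemma budget_iter_tendsto: "(\<lambda>n. budget_iter q n s a) \<longlonglongrightarrow> budget_limit q s a"
  unfolding budget_limit_def by (intro LIMSEQ_SUP incseq_SucI budget_iter_le_Suc)

text \<open>An action that attains the minimum infinitely often lets the limit pass through the
  minimum. It depends on \<open>s'\<close> alone and serves all predecessors at once, so one such
  choice for each state is a stationary policy.\<close>

lemma ex_greedy_action:
  fixes q :: "('s::finite, 'a::finite) damage_kernel"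
  shows "\<exists>b. \<forall>s a d. pmf (q s a) (s', d) > 0 \<longrightarrow> of_bool d + budget_limit q s' b \<le> budget_limit q s a"
proof -
  have "\<exists>b. \<exists>\<^sub>F n in sequentially. budget_iter q n s' b = (MIN a'. budget_iter q n s' a')"
  proof (rule ccontr)
    assume "\<not> ?thesis"
    then have "\<forall>\<^sub>F n in sequentially. budget_iter q n s' b \<noteq> (MIN a'. budget_iter q n s' a')" for b
      by (simp add: not_frequently)
    \<comment> \<open>There are finitely many actions, so a common \<open>n\<close> exists at which
      none of them attains the minimum, which is absurd.\<close>
    then have "\<forall>\<^sub>F n in sequentially. \<forall>b. budget_iter q n s' b \<noteq> (MIN a'. budget_iter q n s' a')"
      by (rule eventually_all_finite)
    then obtain n where n: "\<And>b. budget_iter q n s' b \<noteq> (MIN a'. budget_iter q n s' a')"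
      using eventually_happens'[OF sequentially_bot] by blast
    have "(MIN a'. budget_iter q n s' a') \<in> range (budget_iter q n s')"
      by (rule Min_in) auto
    then show False
      by (rule rangeE) (use n in metis)
  qed
  then obtain b where b: "\<exists>\<^sub>F n in sequentially. budget_iter q n s' b = (MIN a'. budget_iter q n s' a')"
    by (rule exE)
  have "of_bool d + budget_limit q s' b \<le> budget_limit q s a" if d: "pmf (q s a) (s', d) > 0" for s a d
  proof (rule LIMSEQ_le_const2)
    show "(\<lambda>n. of_bool d + budget_iter q n s' b) \<longlonglongrightarrow> of_bool d + budget_limit q s' b"
      by (intro tendsto_add tendsto_const budget_iter_tendsto)
    have "of_bool d + budget_iter q n s' b \<le> budget_limit q s a" for n
    proof -
      \<comment> \<open>The index moves up to some \<open>m\<close> at which \<open>b\<close> is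
        minimal. Monotonicity makes this harmless on the left, and the limit absorbs it on the
        right.\<close>
      obtain m where m: "n \<le> m" "budget_iter q m s' b = (MIN a'. budget_iter q m s' a')"
        using b unfolding frequently_sequentially by blast
      have "budget_iter q n s' b \<le> budget_iter q m s' b"
        using budget_iter_le_Suc m(1) by (rule lift_Suc_mono_le)
      then have "of_bool d + budget_iter q n s' b \<le> of_bool d + (MIN a'. budget_iter q m s' a')"
        unfolding m(2) by (rule add_left_mono)
      also have "\<dots> \<le> budget_iter q (Suc m) s a"
        using d by (rule budget_iter_Suc_ge)
      also have "\<dots> \<le> budget_limit q s a"
        unfolding budget_limit_def by (rule SUP_upper) simp
      finally show ?thesis .
    qed
    then show "\<exists>N. \<forall>n\<ge>N. of_bool d + budget_iter q n s' b \<le> budget_limit q s a"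
      by blast
  qed
  then show ?thesis
    by blast
qed

section \<open>Supports of the true and the consistent kernel\<close>

lemma sets_outcome_cylinder: "({s'} \<times> UNIV \<times> {d}) \<in> sets outcome_space"
  unfolding outcome_space_def by (intro pair_measureI) auto

lemma sets_step_cylinder: "{b} \<times> ({s'} \<times> UNIV \<times> {d}) \<in> sets step_space"
  unfolding step_space_def by (intro pair_measureI sets_outcome_cylinder) simp

lemma emeasure_outcome_cylinder:
  assumes "prob_kernel p"
  shows "emeasure (p s a) ({s'} \<times> UNIV \<times> {d}) = ennreal (state_damage_prob p s a s' d)"
proof -
  interpret prob_space "p s a"
    using assms by (simp add: prob_kernel_def space_prob_algebra)
  have "{(s', r, d) | r. True} = {s'} \<times> (UNIV :: real set) \<times> {d}"
    by auto
  then show ?thesis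
    unfolding state_damage_prob_def by (simp only: emeasure_eq_measure)
qed

text \<open>Consistency enters the argument only in this form, as equality of supports.\<close>

lemma consistent_kernel_pos_iff:
  assumes "consistent_kernel q p"
  shows "pmf (q s a) (s', d) > 0 \<longleftrightarrow> state_damage_prob p s a s' d > 0"
proof -
  have "sgn (pmf (q s a) (s', d)) = sgn (state_damage_prob p s a s' d)"
    using assms by (simp only: consistent_kernel_def)
  then show ?thesis
    by (simp add: sgn_if split: if_splits)
qed

lemma space_trajectory_law:
  fixes p :: "('s::finite, 'a::finite) kernel"
  assumes "prob_kernel p"
  shows "space (trajectory_law p \<pi> s k \<alpha>) = UNIV"
  using sets_eq_imp_space_eq[OF trajectory_law(2)[OF assms]] by (simp add: space_PiM)

text \<open>Next state and damage take finitely many values, so \<open>N\<close> gives a countable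
  union of null cylinders, whatever the rewards are.\<close>

lemma emeasure_outcome_null:
  fixes p :: "('s::finite, 'a) kernel"
  assumes p: "prob_kernel p"
    and null: "\<And>s' d. (s', d) \<in> N \<Longrightarrow> \<not> state_damage_prob p s a s' d > 0"
  shows "emeasure (p s a) (\<Union>(s', d)\<in>N. ({s'} \<times> UNIV \<times> {d})) = 0"
proof -
  have "sets (p s a) = sets outcome_space"
    using p by (simp add: prob_kernel_def space_prob_algebra)
  then have "({s'} \<times> UNIV \<times> {d}) \<in> null_sets (p s a)" if "(s', d) \<in> N" for s' d
    using null[OF that] sets_outcome_cylinder[of s' d]
    by (simp add: null_sets_def emeasure_outcome_cylinder[OF p] not_less ennreal_neg)
  then have "(\<Union>(s', d)\<in>N. ({s'} \<times> UNIV \<times> {d})) \<in> null_sets (p s a)"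
    by (intro null_sets_UN') (auto intro: countable_finite)
  then show ?thesis
    by (rule null_setsD1)
qed

section \<open>Upper bound by a stationary greedy policy\<close>

text \<open>Given the current state \<open>z\<close>, the action is the fixed \<open>b z\<close>,
  and the outcomes outside the support of \<open>q z (b z)\<close> are null for
  \<open>p z (b z)\<close>. The exceptional events for the finitely many \<open>z\<close> are then
  combined. The case \<open>t = 0\<close> is separate because the first action is \<open>a\<close>,
  not \<open>g s\<close>.\<close>

lemma AE_greedy_step:
  fixes p :: "('s::finite, 'a::finite) kernel" and g :: "'s \<Rightarrow> 'a"
  assumes p: "prob_kernel p" and q: "consistent_kernel q p"
  defines "\<pi> \<equiv> \<lambda>z _. return_pmf (g z)"
  shows "AE \<omega> in trajectory_law p \<pi> s k (return_pmf a).
    pmf (q (state_at s \<omega> t) (if t = 0 then a else g (state_at s \<omega> t)))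
      (state_at s \<omega> (Suc t), next_damage \<omega> t) > 0"
proof -
  let ?L = "trajectory_law p \<pi> s k (return_pmf a)"
  define b where "b z = (if t = 0 then a else g z)" for z
  define N where "N z = {(s', d). \<not> pmf (q z (b z)) (s', d) > 0}" for z
  define B :: "'s \<Rightarrow> ('a \<times> 's outcome) set"
    where "B z = (\<Union>c. \<Union>(s', d)\<in>N z. {c} \<times> {s'} \<times> UNIV \<times> {d})" for z
  have B: "B z \<in> sets step_space" for z
    unfolding B_def using sets_step_cylinder by (intro sets.finite_UN) auto
  have "emeasure ?L {\<omega>. state_at s \<omega> t = z \<and> \<omega> t \<in> B z} = 0" for z
  proof -
    have "Pair (b z) -` B z = (\<Union>(s', d)\<in>N z. {s'} \<times> UNIV \<times> {d})"
      unfolding B_def by blast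
    then have "emeasure (step_law p (return_pmf (b z)) z) (B z) =
        emeasure (p z (b z)) (\<Union>(s', d)\<in>N z. {s'} \<times> UNIV \<times> {d})"
      by (simp add: emeasure_step_law[OF p B])
    also have "\<dots> = 0"
      by (rule emeasure_outcome_null[OF p]) (auto simp: N_def consistent_kernel_pos_iff[OF q])
    finally have null: "emeasure (step_law p (return_pmf (b z)) z) (B z) = 0" .
    have "{\<omega>. state_at s \<omega> t = z} \<inter> space (PiM {0..<t} (\<lambda>_. step_space))
        \<in> sets (PiM {0..<t} (\<lambda>_. step_space :: ('a \<times> 's outcome) measure))"
      using measurable_sets[OF measurable_state_at[of t "{0..<t}" s], of "{z}"]
      by (simp add: vimage_def lessThan_atLeast0)
    moreover have "emeasure (trajectory_step p \<pi> s k (return_pmf a) t \<omega>) (B z) = 0"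
      if "state_at s \<omega> t = z" for \<omega>
    proof -
      have "trajectory_step p \<pi> s k (return_pmf a) t \<omega> = step_law p (return_pmf (b z)) z"
        using that by (auto simp: trajectory_step_def \<pi>_def b_def)
      with null show ?thesis
        by (simp only:)
    qed
    ultimately have "emeasure ?L {\<omega>. state_at s \<omega> t = z \<and> \<omega> t \<in> B z} =
        0 * emeasure ?L {\<omega>. state_at s \<omega> t = z}"
      by (intro emeasure_trajectory_law_step[OF p B]) simp_all
    then show ?thesis
      by simp
  qed
  moreover have "{\<omega>. state_at s \<omega> t = z \<and> \<omega> t \<in> B z} \<in> sets ?L" for z
  proof -
    have "(\<lambda>\<omega>. state_at s \<omega> t) \<in> ?L \<rightarrow>\<^sub>M count_space UNIV"
      unfolding measurable_cong_sets[OF trajectory_law(2)[OF p] refl]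
      by (rule measurable_state_at) simp
    then have "(\<lambda>\<omega>. state_at s \<omega> t) -` {z} \<inter> space ?L \<in> sets ?L"
      by (rule measurable_sets) simp
    moreover have "(\<lambda>\<omega>. \<omega> t) \<in> ?L \<rightarrow>\<^sub>M step_space"
      unfolding measurable_cong_sets[OF trajectory_law(2)[OF p] refl]
      by (rule measurable_component_singleton) simp
    then have "(\<lambda>\<omega>. \<omega> t) -` B z \<inter> space ?L \<in> sets ?L"
      using B by (rule measurable_sets)
    ultimately have "((\<lambda>\<omega>. state_at s \<omega> t) -` {z} \<inter> space ?L) \<inter> ((\<lambda>\<omega>. \<omega> t) -` B z \<inter> space ?L) \<in> sets ?L"
      by (rule sets.Int)
    then show ?thesis
      by (rule back_subst[where P="\<lambda>A. A \<in> _"]) (auto simp: space_trajectory_law[OF p])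
  qed
  ultimately have "AE \<omega> in ?L. \<not> (state_at s \<omega> t = z \<and> \<omega> t \<in> B z)" for z
    by (intro AE_I'[where N="{\<omega>. state_at s \<omega> t = z \<and> \<omega> t \<in> B z}"]) (auto intro!: null_setsI)
  then have "AE \<omega> in ?L. \<forall>z. \<not> (state_at s \<omega> t = z \<and> \<omega> t \<in> B z)"
    unfolding AE_all_countable by (rule allI)
  then show ?thesis
  proof eventually_elim
    case (elim \<omega>)
    obtain c s' r d where \<omega>: "\<omega> t = (c, s', r, d)"
      by (metis prod.collapse)
    have "\<omega> t \<notin> B (state_at s \<omega> t)"
      using elim by blast
    then have "(s', d) \<notin> N (state_at s \<omega> t)"
      unfolding B_def \<omega> by blast
    then show ?case
      by (simp add: N_def b_def next_damage_def \<omega> split: if_splits)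
  qed
qed

text \<open>Damage so far plus the limit at the current state and action is a potential: by
  \<open>g\<close>, a possible transition that adds \<open>d\<close> to the count lowers the limit
  by at least \<open>d\<close>. The potential starts at \<open>budget_limit q s a\<close> and
  dominates the count. The policy ignores the budget, so \<open>k\<close> is arbitrary.\<close>

lemma AE_greedy_total_damage_le:
  fixes p :: "('s::finite, 'a::finite) kernel"
  assumes p: "prob_kernel p" and q: "consistent_kernel q p"
    and g: "\<And>s s' a d. pmf (q s a) (s', d) > 0 \<Longrightarrow>
      of_bool d + budget_limit q s' (g s') \<le> budget_limit q s a"
  shows "AE \<omega> in trajectory_law p (\<lambda>z _. return_pmf (g z)) s k (return_pmf a).
    total_damage \<omega> \<le> budget_limit q s a"
proof -
  let ?L = "trajectory_law p (\<lambda>z _. return_pmf (g z)) s k (return_pmf a)"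
  let ?b = "\<lambda>\<omega> t. if t = 0 then a else g (state_at s \<omega> t)"
  have "AE \<omega> in ?L. \<forall>t. pmf (q (state_at s \<omega> t) (?b \<omega> t)) (state_at s \<omega> (Suc t), next_damage \<omega> t) > 0"
    unfolding AE_all_countable using AE_greedy_step[OF p q] by blast
  then show ?thesis
  proof eventually_elim
    case (elim \<omega>)
    have "enat (damage_count \<omega> t) + budget_limit q (state_at s \<omega> t) (?b \<omega> t) \<le> budget_limit q s a" for t
    proof (induction t)
      case (Suc t)
      have "enat (damage_count \<omega> (Suc t)) + budget_limit q (state_at s \<omega> (Suc t)) (?b \<omega> (Suc t)) =
          enat (damage_count \<omega> t) + (of_bool (next_damage \<omega> t) +
            budget_limit q (state_at s \<omega> (Suc t)) (g (state_at s \<omega> (Suc t))))"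
        by (simp add: enat_damage_count add.assoc del: state_at.simps damage_count_Suc)
      also have "\<dots> \<le> enat (damage_count \<omega> t) + budget_limit q (state_at s \<omega> t) (?b \<omega> t)"
        using elim by (intro add_left_mono g) blast
      finally show ?case
        using Suc.IH by (rule order_trans)
    qed (simp add: zero_enat_def[symmetric])
    then have "enat (damage_count \<omega> t) \<le> budget_limit q s a" for t
      by (rule order_trans[OF add_increasing2[OF zero_le order_refl]])
    then show ?case
      unfolding total_damage_le_iff by (rule allI)
  qed
qed

section \<open>Lower bound against an arbitrary policy\<close>

text \<open>Here \<open>n\<close> is the number of steps left: damage \<open>m\<close> has been
  forced so far, and the last term bounds what can still be forced from \<open>z\<close>. It is a
  minimum over actions because the policy makes the next choice, except at time 0, where the action
  is \<open>a\<close>.\<close>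

lemma ex_probable_damage:
  fixes p :: "('s::finite, 'a::finite) kernel"
  assumes p: "prob_kernel p" and q: "consistent_kernel q p"
  shows "\<exists>z m. emeasure (trajectory_law p \<pi> s k (return_pmf a))
      {\<omega>. state_at s \<omega> t = z \<and> damage_count \<omega> t = m} \<noteq> 0 \<and>
    budget_iter q (t + n) s a \<le>
      enat m + (if t = 0 then budget_iter q n z a else (MIN b. budget_iter q n z b))"
proof (induction t arbitrary: n)
  case 0
  have "emeasure (trajectory_law p \<pi> s k (return_pmf a)) UNIV = 1"
    using prob_space.emeasure_space_1[OF trajectory_law(1)[OF p]] by (simp add: space_trajectory_law[OF p])
  then show ?case
    by (intro exI[of _ s] exI[of _ 0]) (simp add: zero_enat_def[symmetric])
next
  case (Suc t)
  let ?L = "trajectory_law p \<pi> s k (return_pmf a)"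
  let ?V = "\<lambda>t n z. if t = 0 then budget_iter q n z a else (MIN b. budget_iter q n z b)"
  let ?Q = "\<lambda>t z m \<omega>. state_at s \<omega> t = z \<and> damage_count \<omega> t = m"
  have Q: "{\<omega>. ?Q t z m \<omega>} \<inter> space (PiM I (\<lambda>_. step_space))
      \<in> sets (PiM I (\<lambda>_. step_space :: ('a \<times> 's outcome) measure))" if "{..<t} \<subseteq> I" for I t z m
  proof -
    have "((\<lambda>\<omega>. state_at s \<omega> t) -` {z} \<inter> space (PiM I (\<lambda>_. step_space))) \<inter>
        ((\<lambda>\<omega>. damage_count \<omega> t) -` {m} \<inter> space (PiM I (\<lambda>_. step_space)))
        \<in> sets (PiM I (\<lambda>_. step_space :: ('a \<times> 's outcome) measure))"
      using that measurable_state_at measurable_damage_count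
      by (intro sets.Int measurable_sets[where A="count_space UNIV"]) auto
    then show ?thesis
      by (rule back_subst[where P="\<lambda>A. A \<in> _"]) auto
  qed
  \<comment> \<open>The induction hypothesis is used at \<open>Suc n\<close>, since the new step
    consumes one unit of the horizon.\<close>
  obtain z m where pos: "emeasure ?L {\<omega>. ?Q t z m \<omega>} \<noteq> 0"
    and le: "budget_iter q (t + Suc n) s a \<le> enat m + ?V t (Suc n) z"
    using Suc.IH by blast
  \<comment> \<open>On the event for \<open>z\<close> and \<open>m\<close> the budget is
    \<open>k\<close> minus \<open>m\<close>, so all its trajectories share this action law.\<close>
  define \<beta> where "\<beta> = (if t = 0 then return_pmf a else \<pi> z (ereal_of_enat k - ereal (real m)))"
  \<comment> \<open>At time 0 the action must be \<open>a\<close>. Later any action of positive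
    probability will do, as its value is at least the minimum.\<close>
  obtain b where b: "b \<in> set_pmf \<beta>" and Vb: "?V t (Suc n) z \<le> budget_iter q (Suc n) z b"
  proof (cases "t = 0")
    case True
    then show ?thesis
      by (intro that[of a]) (auto simp: \<beta>_def)
  next
    case False
    obtain b where "b \<in> set_pmf \<beta>"
      using set_pmf_not_empty[of \<beta>] by blast
    with False show ?thesis
      by (intro that[of b]) (auto simp del: budget_iter.simps)
  qed
  \<comment> \<open>The worst transition for \<open>b\<close> is selected. It has positive
    probability under \<open>q\<close>, hence also under \<open>p\<close>.\<close>
  obtain s' d where d: "pmf (q z b) (s', d) > 0"
    and Suc_n: "budget_iter q (Suc n) z b = of_bool d + (MIN a'. budget_iter q n s' a')"
    by (rule budget_iter_Suc_witness)
  let ?C = "({s'} \<times> UNIV \<times> {d})"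
  let ?B = "{b} \<times> ?C"
  have "emeasure (step_law p \<beta> z) ?B \<noteq> 0"
  proof
    assume "emeasure (step_law p \<beta> z) ?B = 0"
    then have "AE c in measure_pmf \<beta>. emeasure (p z c) (Pair c -` ?B) = 0"
      by (simp add: emeasure_step_law[OF p sets_step_cylinder] nn_integral_0_iff_AE)
    then have "emeasure (p z b) (Pair b -` ?B) = 0"
      using b unfolding AE_measure_pmf_iff by (rule bspec)
    then have "emeasure (p z b) ?C = 0"
      by simp
    with d show False
      by (simp add: emeasure_outcome_cylinder[OF p] consistent_kernel_pos_iff[OF q] ennreal_eq_0_iff)
  qed
  moreover have "emeasure ?L {\<omega>. ?Q t z m \<omega> \<and> \<omega> t \<in> ?B} =
      emeasure (step_law p \<beta> z) ?B * emeasure ?L {\<omega>. ?Q t z m \<omega>}"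
    by (rule emeasure_trajectory_law_step[OF p sets_step_cylinder _ Q])
      (auto simp: trajectory_step_def \<beta>_def budget_at_eq)
  ultimately have "0 < emeasure ?L {\<omega>. ?Q t z m \<omega> \<and> \<omega> t \<in> ?B}"
    using pos by (simp add: zero_less_iff_neq_zero)
  also have "\<dots> \<le> emeasure ?L {\<omega>. ?Q (Suc t) s' (m + of_bool d) \<omega>}"
    using Q[of "Suc t" UNIV]
    by (intro emeasure_mono) (auto simp: next_damage_def trajectory_law(2)[OF p] space_PiM)
  finally have "emeasure ?L {\<omega>. ?Q (Suc t) s' (m + of_bool d) \<omega>} \<noteq> 0"
    by (simp only: zero_less_iff_neq_zero not_False_eq_True)
  moreover have "budget_iter q (Suc t + n) s a \<le> enat (m + of_bool d) + (MIN a'. budget_iter q n s' a')"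
  proof -
    have "budget_iter q (Suc t + n) s a \<le> enat m + ?V t (Suc n) z"
      using le by (simp del: budget_iter.simps)
    also have "\<dots> \<le> enat m + (of_bool d + (MIN a'. budget_iter q n s' a'))"
      using Vb unfolding Suc_n by (rule add_left_mono)
    also have "\<dots> = enat (m + of_bool d) + (MIN a'. budget_iter q n s' a')"
      by (simp add: add.assoc[symmetric] of_bool_def one_enat_def zero_enat_def)
    finally show ?thesis .
  qed
  ultimately show ?case
    unfolding if_not_P[OF Suc_not_Zero] by (intro exI conjI)
qed

text \<open>At time \<open>n\<close> with no steps left the remaining value is 0, so damage of at
  least \<open>budget_iter q n s a\<close> has occurred with positive probability. An almost sure
  bound \<open>k\<close> on the total damage cannot lie below it.\<close>

lemma budget_iter_le:
  fixes p :: "('s::finite, 'a::finite) kernel"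
  assumes p: "prob_kernel p" and q: "consistent_kernel q p"
    and AE: "AE \<omega> in trajectory_law p \<pi> s k (return_pmf a). total_damage \<omega> \<le> k"
  shows "budget_iter q n s a \<le> k"
proof -
  let ?L = "trajectory_law p \<pi> s k (return_pmf a)"
  obtain z m where pos: "emeasure ?L {\<omega>. state_at s \<omega> n = z \<and> damage_count \<omega> n = m} \<noteq> 0"
    and "budget_iter q (n + 0) s a \<le>
      enat m + (if n = 0 then budget_iter q 0 z a else (MIN b. budget_iter q 0 z b))"
    using ex_probable_damage[OF p q] by blast
  note this(2)
  also have "enat m + (if n = 0 then budget_iter q 0 z a else (MIN b. budget_iter q 0 z b)) = enat m"
    by (simp add: image_constant_conv)
  also have "enat m \<le> k"
  proof (rule ccontr)
    assume "\<not> enat m \<le> k"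
    then have "AE \<omega> in ?L. \<not> (state_at s \<omega> n = z \<and> damage_count \<omega> n = m)"
      using AE by (auto simp: total_damage_le_iff elim!: eventually_mono)
    then have "emeasure ?L {\<omega> \<in> space ?L. state_at s \<omega> n = z \<and> damage_count \<omega> n = m} = 0"
      by (rule emeasure_eq_0_AE)
    with pos show False
      by (simp add: space_trajectory_law[OF p])
  qed
  finally show ?thesis
    by simp
qed

section \<open>Identification of the minimal budget with the limit\<close>

text \<open>The greedy policy makes the limit a sufficient budget, which bounds the least one from
  above. Every sufficient budget dominates all iterates and hence their supremum.\<close>

lemma min_budget_eq_budget_limit:
  fixes p :: "('s::finite, 'a::finite) kernel"
  assumes p: "prob_kernel p" and q: "consistent_kernel q p"
  shows "min_budget p s a = budget_limit q s a"
proof (rule antisym)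
  have "\<forall>s'. \<exists>b. \<forall>s a d. pmf (q s a) (s', d) > 0 \<longrightarrow>
      of_bool d + budget_limit q s' b \<le> budget_limit q s a"
    using ex_greedy_action by blast
  then obtain g where g: "\<And>s s' a d. pmf (q s a) (s', d) > 0 \<Longrightarrow>
      of_bool d + budget_limit q s' (g s') \<le> budget_limit q s a"
    by metis
  have "optimal_barrier p s (budget_limit q s a) a = 0"
    unfolding optimal_barrier_eq_0_iff[OF p] using AE_greedy_total_damage_le[OF p q g] by blast
  then show "min_budget p s a \<le> budget_limit q s a"
    unfolding min_budget_def by (rule Least_le)
  \<comment> \<open>The same fact shows that a sufficient budget exists, so the least one is itself
    sufficient.\<close>
  from \<open>optimal_barrier p s (budget_limit q s a) a = 0\<close>
  have "optimal_barrier p s (min_budget p s a) a = 0"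
    unfolding min_budget_def by (rule LeastI)
  then show "budget_limit q s a \<le> min_budget p s a"
    unfolding optimal_barrier_eq_0_iff[OF p] budget_limit_def
    using budget_iter_le[OF p q] by (blast intro: SUP_least)
qed

theorem lemma15:
  fixes p :: "('s::finite, 'a::finite) kernel"
    and p_hat :: "('s, 'a) damage_kernel"
  assumes "cmdp p"
    and "consistent_kernel p_hat p"
  shows "\<forall>s a. (\<lambda>n. budget_iter p_hat n s a) \<longlonglongrightarrow> min_budget p s a"
  using assms by (simp add: cmdp_def min_budget_eq_budget_limit budget_iter_tendsto)

end
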